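(* Let $A\in\mathbb{R}^{m\times n}$ have no zero rows and rank $r$, let $0<\omega<2$, let $L$, $G$, $\mathcal V$, $A^{\#}$, $A_k^{\#}$ be as defined in the context, and assume that $G|_{\mathcal V}$ is diagonalizable (over $\mathbb{C}$), with eigenvalue decomposition $G|_{\mathcal V}=W\Lambda W^{-1}$, $\Lambda=\mathrm{diag}(\lambda_1,\dots,\lambda_r)$. Let $\mathbf e\sim\mathcal N(\mathbf 0,\sigma^2 I)$ be a Gaussian random vector in $\mathbb{R}^m$. For an integer $k\ge 1$ put $\Phi_k=I-\Lambda^k=\mathrm{diag}(1-\lambda_i^k)$, $\boldsymbol\xi=W^{-1}A^{\#}\mathbf e$ with components $\xi_i$, and $\boldsymbol\xi^k=W^{-1}A_k^{\#}\mathbf e$. Then $$\mathbb{E}\bigl(\|A_k^{\#}\mathbf e\|^2\bigr)=\sigma^2\,\|A_k^{\#}\|_{\mathrm F}^2=\sigma^2\,\|W\,\Phi_k\,W^{-1}A^{\#}\|_{\mathrm F}^2$$ and $$\mathbb{E}\bigl(\|\boldsymbol\xi^k\|^2\bigr)=\sum_{i=1}^{r}|1-\lambda_i^k|^2\;\mathbb{E}\bigl(|\xi_i|^2\bigr).$$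
   Context: Write $AA^\top=\widehat L+D+\widehat L^\top$ with $\widehat L$ strictly lower triangular and $D$ diagonal, and set $L=\widehat L+\omega^{-1}D$, which is nonsingular because $A$ has no zero rows. Let $G=I-A^\top L^{-1}A\in\mathbb{R}^{n\times n}$ and $\mathcal V=\mathrm{range}(A^\top)=\mathrm{null}(A)^\perp$; $G$ and $A^\top L^{-1}A$ map $\mathcal V$ into $\mathcal V$, and for $0<\omega<2$ the restriction $A^\top L^{-1}A|_{\mathcal V}:\mathcal V\to\mathcal V$ is invertible. Define $A^{\#}=(A^\top L^{-1}A|_{\mathcal V})^{-1}A^\top L^{-1}\in\mathbb{R}^{n\times m}$ and $A_k^{\#}=(I+G+\cdots+G^{k-1})A^\top L^{-1}=(I-G^k)A^{\#}$, so that the $k$th Kaczmarz iterate with zero starting vector and right-hand side $\mathbf b$ is $A_k^{\#}\mathbf b$. The eigenvalue decomposition of $G|_{\mathcal V}$ means the following: let the columns of $V\in\mathbb{R}^{n\times r}$ form an orthonormal basis of $\mathcal V$, let $V^\top GV=C\Lambda C^{-1}$ with $C\in\mathbb{C}^{r\times r}$ invertible, and put $W=VC\in\mathbb{C}^{n\times r}$; on $\mathcal V$ (or its complexification) $W^{-1}$ denotes the map $C^{-1}V^\top$. Eigenvalues and eigenvectors may be complex. $\|\cdot\|$ is the Euclidean norm, $\|\cdot\|_{\mathrm F}$ the Frobenius norm, $\mathbb{E}$ the expected value. *)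

theory Defs
  imports "HOL-Probability.Probability"
begin

text \<open>The class operations \<open>*\<close> and \<open>^\<close> act componentwise on \<open>vec\<close>, hence a separate power
  for the matrix product.\<close>

primrec matpow :: "'a::semiring_1^'n^'n \<Rightarrow> nat \<Rightarrow> 'a^'n^'n" where
  "matpow M 0 = mat 1"
| "matpow M (Suc k) = M ** matpow M k"

definition diag_mat :: "'a::zero^'n \<Rightarrow> 'a^'n^'n" where
  "diag_mat d = (\<chi> i j. if i = j then d $ i else 0)"

definition frobenius_norm :: "'a::real_normed_vector^'n^'m \<Rightarrow> real" where
  "frobenius_norm M = sqrt (\<Sum>i\<in>UNIV. \<Sum>j\<in>UNIV. (norm (M $ i $ j))\<^sup>2)"

lemma frobenius_norm_eq_norm: "frobenius_norm M = norm M"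
  unfolding frobenius_norm_def norm_vec_def L2_set_def
  by (simp add: sum_nonneg)

abbreviation cmat :: "real^'n^'m \<Rightarrow> complex^'n^'m" where
  "cmat \<equiv> map_matrix complex_of_real"

definition cvec :: "real^'n \<Rightarrow> complex^'n" where
  "cvec x = (\<chi> i. complex_of_real (x $ i))"

definition lower_part ::
  "real^'n^'m::{finite,linorder} \<Rightarrow> real^'m::{finite,linorder}^'m::{finite,linorder}" where
  "lower_part A = (\<chi> i j. if j < i then (A ** transpose A) $ i $ j else 0)"

definition diag_part ::
  "real^'n^'m::{finite,linorder} \<Rightarrow> real^'m::{finite,linorder}^'m::{finite,linorder}" where
  "diag_part A = (\<chi> i j. if i = j then (A ** transpose A) $ i $ j else 0)"

lemma gram_splitting:
  "A ** transpose A = lower_part A + diag_part A + transpose (lower_part A)"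
proof -
  have "(A ** transpose A) $ j $ i = (A ** transpose A) $ i $ j" for i j
    by (simp add: matrix_matrix_mult_def transpose_def mult.commute)
  moreover have "transpose (lower_part A) $ i $ j = lower_part A $ j $ i" for i j
    by (simp add: transpose_def)
  ultimately show ?thesis
    unfolding vec_eq_iff
    by (auto simp only: vector_add_component) (auto simp: lower_part_def diag_part_def)
qed

definition sor_L ::
  "real^'n^'m::{finite,linorder} \<Rightarrow> real \<Rightarrow> real^'m::{finite,linorder}^'m::{finite,linorder}" where
  "sor_L A \<omega> = lower_part A + inverse \<omega> *\<^sub>R diag_part A"

definition AtLinv ::
  "real^'n^'m::{finite,linorder} \<Rightarrow> real \<Rightarrow> real^'m::{finite,linorder}^'n" where
  "AtLinv A \<omega> = transpose A ** matrix_inv (sor_L A \<omega>)"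

definition iter_G :: "real^'n^'m::{finite,linorder} \<Rightarrow> real \<Rightarrow> real^'n^'n" where
  "iter_G A \<omega> = mat 1 - AtLinv A \<omega> ** A"

definition row_range :: "real^'n^'m \<Rightarrow> (real^'n) set" where
  "row_range A = range (\<lambda>y. transpose A *v y)"

text \<open>\<open>inv_into (row_range A)\<close> inverts the restriction to \<open>row_range A\<close> of the map with matrix
  \<open>AtLinv A \<omega> ** A\<close>, which is a bijection of \<open>row_range A\<close> if \<open>A\<close> has no zero rows
  and \<open>0 < \<omega> < 2\<close>.\<close>

definition A_sharp ::
  "real^'n^'m::{finite,linorder} \<Rightarrow> real \<Rightarrow> real^'m::{finite,linorder}^'n" where
  "A_sharp A \<omega> = matrix (\<lambda>b.
     inv_into (row_range A) (\<lambda>x. (AtLinv A \<omega> ** A) *v x) (AtLinv A \<omega> *v b))"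

definition A_sharp_k ::
  "real^'n^'m::{finite,linorder} \<Rightarrow> real \<Rightarrow> nat \<Rightarrow> real^'m::{finite,linorder}^'n" where
  "A_sharp_k A \<omega> k = (\<Sum>j<k. matpow (iter_G A \<omega>) j) ** AtLinv A \<omega>"

definition orthonormal_basis_columns :: "real^'r^'n \<Rightarrow> (real^'n) set \<Rightarrow> bool" where
  "orthonormal_basis_columns V S \<longleftrightarrow>
     (\<forall>i j. column i V \<bullet> column j V = (if i = j then 1 else 0)) \<and> span (columns V) = S"

definition eig_decomp ::
  "real^'n^'n \<Rightarrow> (real^'n) set \<Rightarrow> real^'r^'n \<Rightarrow> complex^'r^'r \<Rightarrow> complex^'r \<Rightarrow> bool" where
  "eig_decomp G S V C l \<longleftrightarrow>
     orthonormal_basis_columns V S \<and> invertible C \<and>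
     cmat (transpose V ** G ** V) = C ** diag_mat l ** matrix_inv C"

definition eig_W :: "real^'r^'n \<Rightarrow> complex^'r^'r \<Rightarrow> complex^'r^'n" where
  "eig_W V C = cmat V ** C"

text \<open>Inverse of \<open>eig_W V C\<close> on the complexified column space of \<open>V\<close>.\<close>

definition eig_Winv :: "real^'r^'n \<Rightarrow> complex^'r^'r \<Rightarrow> complex^'n^'r" where
  "eig_Winv V C = matrix_inv C ** cmat (transpose V)"

text \<open>The normal law with standard deviation \<open>\<sigma>\<close>; a point mass if \<open>\<sigma> = 0\<close>
  (where \<open>normal_density\<close> vanishes identically).\<close>

definition normal_law :: "real \<Rightarrow> real \<Rightarrow> real measure" where
  "normal_law \<mu> \<sigma> =
     (if \<sigma> = 0 then return borel \<mu> else density lborel (\<lambda>x. ennreal (normal_density \<mu> \<sigma> x)))"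

text \<open>\<open>e\<close> has law \<open>N(0, \<sigma>\<^sup>2 I)\<close>: its components are independent, each with law \<open>N(0, \<sigma>\<^sup>2)\<close>.\<close>

definition gaussian_vector :: "'a measure \<Rightarrow> real \<Rightarrow> ('a \<Rightarrow> real^'m) \<Rightarrow> bool" where
  "gaussian_vector M \<sigma> e \<longleftrightarrow>
     e \<in> borel_measurable M \<and>
     prob_space.indep_vars M (\<lambda>_. borel) (\<lambda>i w. e w $ i) UNIV \<and>
     (\<forall>i. distr M borel (\<lambda>w. e w $ i) = normal_law 0 \<sigma>)"

end

theory Submission
  imports Defs
begin

text \<open>
  The symmetric part of \<open>L\<close> is \<open>(A A\<^sup>T + (2/\<omega> - 1) D) / 2\<close>, which is positive definite for
  \<open>0 < \<omega> < 2\<close>. This yields both the invertibility of \<open>L\<close> and the injectivity of \<open>A\<^sup>T L\<^sup>-\<^sup>1 A\<close> on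
  the row space. There the geometric sum telescopes to \<open>A\<^sub>k\<^sup># = (I - G\<^sup>k) A\<^sup>#\<close>, and conjugating by
  the eigenvectors turns \<open>I - G\<^sup>k\<close> into \<open>\<Phi>\<^sub>k\<close>. Consequently \<open>\<xi>\<^sup>k\<close> is \<open>\<xi>\<close> scaled
  componentwise by \<open>1 - \<lambda>\<^sub>i\<^sup>k\<close>. The expectations reduce to the covariance \<open>\<sigma>\<^sup>2 I\<close> of \<open>e\<close>.
\<close>

subsection \<open>Matrices\<close>

lemma matrix_diff_ldistrib: "A ** (B - C) = A ** B - A ** C" for A :: "'a::ring_1^'n^'m"
  by (simp add: matrix_matrix_mult_def vec_eq_iff sum_subtractf algebra_simps)

lemma matrix_diff_rdistrib: "(B - C) ** A = B ** A - C ** A" for A :: "'a::ring_1^'n^'m"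
  by (simp add: matrix_matrix_mult_def vec_eq_iff sum_subtractf algebra_simps)

lemma matrix_add_rdistrib: "(B + C) ** A = B ** A + C ** A" for A :: "'a::semiring_1^'n^'m"
  by (simp add: matrix_matrix_mult_def vec_eq_iff sum.distrib algebra_simps)

lemma matpow_commute: "matpow M k ** M = M ** matpow M k"
  by (induction k) (simp_all add: matrix_mul_assoc [symmetric])

text \<open>Telescoping. The factor \<open>mat 1 - M\<close> stands on the right because
  \<open>AtLinv A \<omega>\<close>, the right factor in \<open>A_sharp_k\<close>, gets rewritten as
  \<open>(mat 1 - iter_G A \<omega>) ** A_sharp A \<omega>\<close>.\<close>

lemma matpow_geometric_sum:
  fixes M :: "'a::ring_1^'n^'n"
  shows "(\<Sum>j<k. matpow M j) ** (mat 1 - M) = mat 1 - matpow M k"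
proof (induction k)
  case (Suc k)
  have "(\<Sum>j<Suc k. matpow M j) ** (mat 1 - M) =
      (\<Sum>j<k. matpow M j) ** (mat 1 - M) + matpow M k ** (mat 1 - M)"
    by (simp add: matrix_add_rdistrib)
  then show ?case
    by (simp add: Suc.IH) (simp add: matrix_diff_ldistrib matpow_commute)
qed simp

text \<open>Moves powers across \<open>X\<close> without inverting it. It serves for the rectangular
  \<open>V\<close>, between \<open>iter_G\<close> and its compression, and for \<open>C\<close>,
  between the compression and the diagonal matrix.\<close>

lemma matpow_intertwine:
  assumes "M ** X = X ** N"
  shows "matpow M k ** X = X ** matpow N k"
proof (induction k)
  case (Suc k)
  have "matpow M (Suc k) ** X = M ** X ** matpow N k"
    using Suc by (simp add: matrix_mul_assoc [symmetric])
  then show ?case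
    using assms by (simp add: matrix_mul_assoc)
qed simp

lemma matpow_diag_mat: "matpow (diag_mat d) k = diag_mat (\<chi> i. d $ i ^ k)"
proof (induction k)
  case 0
  show ?case
    by (simp add: diag_mat_def mat_def vec_eq_iff)
next
  case (Suc k)
  then show ?case
    by (simp add: diag_mat_def matrix_matrix_mult_def vec_eq_iff if_distrib if_distribR
        cong: if_cong)
qed

lemma mat_minus_diag_mat: "mat 1 - diag_mat d = diag_mat (\<chi> i. 1 - d $ i)"
  for d :: "'a::ring_1^'n"
  by (simp add: diag_mat_def mat_def vec_eq_iff)

lemma diag_mat_mult_vec: "(diag_mat d *v x) $ i = d $ i * x $ i"
  for d :: "'a::semiring_1^'n"
  by (simp add: diag_mat_def matrix_vector_mult_def if_distrib if_distribR cong: if_cong)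

section \<open>Real matrices and vectors viewed over the complex numbers\<close>

lemma cmat_mult: "cmat (X ** Y) = cmat X ** cmat Y"
  by (simp add: map_matrix_def matrix_matrix_mult_def vec_eq_iff)

lemma cmat_diff: "cmat (X - Y) = cmat X - cmat Y"
  by (simp add: map_matrix_def vec_eq_iff)

lemma cmat_mat_1: "cmat (mat 1) = mat 1"
  by (simp add: map_matrix_def mat_def vec_eq_iff)

lemma cmat_matpow: "cmat (matpow M k) = matpow (cmat M) k"
  by (induction k) (simp_all add: cmat_mult cmat_mat_1)

lemma cvec_mult: "cvec (X *v x) = cmat X *v cvec x"
  by (simp add: map_matrix_def cvec_def matrix_vector_mult_def vec_eq_iff)

lemma frobenius_norm_cmat: "frobenius_norm (cmat X) = frobenius_norm X"
  by (simp add: frobenius_norm_def map_matrix_def)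

lemma matrix_inv_right:
  fixes X :: "'a::field^'n^'n"
  assumes "invertible X"
  shows "X ** matrix_inv X = mat 1"
  using assms unfolding invertible_def matrix_inv_def by (rule someI2_ex) blast

lemma matrix_inv_left:
  fixes X :: "'a::field^'n^'n"
  assumes "invertible X"
  shows "matrix_inv X ** X = mat 1"
  using assms unfolding invertible_def matrix_inv_def by (rule someI2_ex) blast

lemma norm_vec_squared: "(norm x)\<^sup>2 = (\<Sum>i\<in>UNIV. (norm (x $ i))\<^sup>2)"
  by (simp add: norm_vec_def L2_set_def sum_nonneg)

section \<open>Matrices whose columns form an orthonormal basis\<close>

lemma orthonormal_columns_transpose_mult:
  assumes "orthonormal_basis_columns V S"
  shows "transpose V ** V = mat 1"
  using assms unfolding orthonormal_basis_columns_def
  by (simp add: vec_eq_iff matrix_matrix_mult_def transpose_def mat_def column_def inner_vec_def)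

text \<open>The fixed points of \<open>V ** transpose V\<close> form a subspace, and each column
  \<open>V *v axis j 1\<close> is fixed because \<open>transpose V ** V = mat 1\<close>.\<close>

lemma orthonormal_columns_projection:
  assumes V: "orthonormal_basis_columns V S" and "x \<in> S"
  shows "V *v (transpose V *v x) = x"
proof -
  have "x \<in> span (columns V)"
    using assms unfolding orthonormal_basis_columns_def by simp
  then have "(V ** transpose V) *v x = x"
  proof (induction rule: span_induct)
    case base
    show ?case
      by (simp add: subspace_def matrix_vector_right_distrib matrix_vector_mult_scaleR)
  next
    case (step x)
    then obtain j where "x = V *v axis j 1"
      by (auto simp: columns_def matrix_vector_mult_basis)
    then show ?case
      by (simp add: matrix_vector_mul_assoc matrix_mul_assoc [symmetric]
          orthonormal_columns_transpose_mult [OF V])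
  qed
  then show ?thesis
    by (simp only: matrix_vector_mul_assoc)
qed

lemma orthonormal_columns_projection_matrix:
  assumes "orthonormal_basis_columns V S" and "\<And>b. X *v b \<in> S"
  shows "V ** (transpose V ** X) = X"
  using orthonormal_columns_projection [OF assms(1) assms(2)]
  by (simp add: matrix_eq matrix_vector_mul_assoc [symmetric])

lemma orthonormal_columns_in:
  assumes "orthonormal_basis_columns V S"
  shows "V *v b \<in> S"
  using assms matrix_vector_mult_in_columnspace [of V b]
  unfolding orthonormal_basis_columns_def by simp

subsection \<open>The SOR splitting\<close>

text \<open>Twice \<open>L\<close> is \<open>A A^T + (2/\<omega> - 1) D\<close> plus the
  skew-symmetric difference of the strictly lower part and its transpose, which drops out of the
  quadratic form.\<close>

lemma sor_L_inner:
  fixes A :: "real^'n^'m::{finite,linorder}"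
  shows "2 * (y \<bullet> (sor_L A \<omega> *v y)) =
    (norm (transpose A *v y))\<^sup>2 + (2 * inverse \<omega> - 1) * (y \<bullet> (diag_part A *v y))"
proof -
  have "y \<bullet> (transpose (lower_part A) *v y) = y \<bullet> (lower_part A *v y)"
    by (metis dot_lmul_matrix inner_commute transpose_matrix_vector)
  moreover have "(norm (transpose A *v y))\<^sup>2 = y \<bullet> ((A ** transpose A) *v y)"
    by (metis dot_lmul_matrix matrix_vector_mul_assoc power2_norm_eq_inner transpose_matrix_vector)
  ultimately show ?thesis
    unfolding gram_splitting sor_L_def
    by (simp add: matrix_vector_mult_add_rdistrib inner_right_distrib
        scaleR_matrix_vector_assoc [symmetric] algebra_simps)
qed

lemma diag_part_inner:
  fixes A :: "real^'n^'m::{finite,linorder}"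
  shows "y \<bullet> (diag_part A *v y) = (\<Sum>i\<in>UNIV. (norm (row i A))\<^sup>2 * (y $ i)\<^sup>2)"
proof -
  have "(diag_part A *v y) $ i = (norm (row i A))\<^sup>2 * y $ i" for i
    by (simp add: diag_part_def matrix_vector_mult_def if_distrib if_distribR matrix_matrix_mult_def
        transpose_def power2_norm_eq_inner row_def inner_vec_def cong: if_cong)
  then show ?thesis
    by (simp add: inner_vec_def power2_eq_square algebra_simps)
qed

text \<open>In general \<open>A A^T\<close> is only semidefinite, so strictness comes from
  \<open>D\<close>: its entries are the squared row norms, and \<open>2/\<omega> - 1\<close> is
  positive for \<open>0 < \<omega> < 2\<close>.\<close>

lemma sor_L_pos_def:
  fixes A :: "real^'n^'m::{finite,linorder}"
  assumes rows: "\<forall>i. row i A \<noteq> 0" and "0 < \<omega>" "\<omega> < 2" and "y \<noteq> 0"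
  shows "0 < y \<bullet> (sor_L A \<omega> *v y)"
proof -
  obtain i where i: "y $ i \<noteq> 0"
    using \<open>y \<noteq> 0\<close> by (auto simp: vec_eq_iff)
  have "0 < y \<bullet> (diag_part A *v y)"
    unfolding diag_part_inner using i rows by (intro sum_pos2 [of _ i]) auto
  moreover have "0 < 2 * inverse \<omega> - 1"
    using assms by (simp add: field_simps)
  ultimately have "0 < (2 * inverse \<omega> - 1) * (y \<bullet> (diag_part A *v y))"
    by simp
  then show ?thesis
    using sor_L_inner [of y A \<omega>] zero_le_power2 [of "norm (transpose A *v y)"] by linarith
qed

lemma sor_L_invertible:
  fixes A :: "real^'n^'m::{finite,linorder}"
  assumes "\<forall>i. row i A \<noteq> 0" and "0 < \<omega>" "\<omega> < 2"
  shows "invertible (sor_L A \<omega>)"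
proof -
  have "y = 0" if "sor_L A \<omega> *v y = 0" for y
    using sor_L_pos_def [OF assms, of y] that by force
  then show ?thesis
    using invertible_left_inverse matrix_left_invertible_ker by blast
qed

section \<open>The operator \<open>AtLinv A \<omega> ** A\<close> on the row space and its
  inverse\<close>

lemma AtLinv_in_row_range: "AtLinv A \<omega> *v b \<in> row_range A"
  unfolding AtLinv_def row_range_def by (simp add: matrix_vector_mul_assoc [symmetric])

lemma subspace_row_range: "subspace (row_range A)"
  unfolding row_range_def
  by (intro linear_subspace_image matrix_vector_mul_linear subspace_UNIV)

text \<open>For \<open>u = L^-1 A x\<close> the hypothesis says \<open>A^T u = 0\<close>, so
  \<open>u \<bullet> L u = u \<bullet> A x = A^T u \<bullet> x = 0\<close>. Positive definiteness
  forces \<open>u = 0\<close>, hence \<open>A x = 0\<close>.\<close>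

lemma AtLinv_mult_kernel:
  fixes A :: "real^'n^'m::{finite,linorder}"
  assumes "\<forall>i. row i A \<noteq> 0" and "0 < \<omega>" "\<omega> < 2"
    and x: "x \<in> row_range A" and B: "(AtLinv A \<omega> ** A) *v x = 0"
  shows "x = 0"
proof -
  define u where "u = matrix_inv (sor_L A \<omega>) *v (A *v x)"
  have Lu: "sor_L A \<omega> *v u = A *v x"
    unfolding u_def by (metis matrix_inv_right [OF sor_L_invertible [OF assms(1-3)]]
        matrix_vector_mul_assoc matrix_vector_mul_lid)
  have "transpose A *v u = 0"
    using B unfolding u_def AtLinv_def by (simp add: matrix_vector_mul_assoc matrix_mul_assoc)
  then have "u \<bullet> (A *v x) = 0"
    by (metis dot_lmul_matrix inner_zero_left transpose_matrix_vector)
  then have "u = 0"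
    using sor_L_pos_def [OF assms(1-3), of u] Lu by force
  then have "A *v x = 0"
    using Lu by simp
  moreover obtain y where "x = transpose A *v y"
    using x unfolding row_range_def by blast
  \<comment> \<open>The row space is orthogonal to the kernel of \<open>A\<close>:
    \<open>x \<bullet> x = y \<bullet> (A *v x)\<close>.\<close>
  ultimately have "x \<bullet> x = 0"
    by (metis dot_lmul_matrix inner_zero_right transpose_matrix_vector)
  then show ?thesis
    by simp
qed

text \<open>An injective linear map of a finite-dimensional subspace into itself is onto, by
  comparing dimensions.\<close>

lemma AtLinv_mult_bij:
  fixes A :: "real^'n^'m::{finite,linorder}"
  assumes "\<forall>i. row i A \<noteq> 0" and "0 < \<omega>" "\<omega> < 2"
  shows "bij_betw (\<lambda>x. (AtLinv A \<omega> ** A) *v x) (row_range A) (row_range A)"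
proof -
  let ?B = "\<lambda>x. (AtLinv A \<omega> ** A) *v x"
  have lin: "linear ?B"
    by (rule matrix_vector_mul_linear)
  have inj: "inj_on ?B (row_range A)"
    using AtLinv_mult_kernel [OF assms]
    by (subst linear_inj_on_iff_eq_0 [OF lin subspace_row_range]) blast
  have sub: "?B ` row_range A \<subseteq> row_range A"
    using AtLinv_in_row_range by (auto simp: matrix_vector_mul_assoc [symmetric])
  have "dim (?B ` row_range A) = dim (row_range A)"
    using inj by (intro dim_image_eq [OF lin]) (simp add: span_eq_iff [THEN iffD2] subspace_row_range)
  then have "?B ` row_range A = row_range A"
    by (intro subspace_dim_equal linear_subspace_image lin subspace_row_range sub) simp
  with inj show ?thesis
    by (simp add: bij_betw_def)
qed

text \<open>\<open>A_sharp\<close> is the \<open>matrix\<close> of a function built from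
  \<open>inv_into\<close>; it represents that function only once linearity is established.\<close>

lemma A_sharp_apply:
  fixes A :: "real^'n^'m::{finite,linorder}"
  assumes "\<forall>i. row i A \<noteq> 0" and "0 < \<omega>" "\<omega> < 2"
  shows A_sharp_in_row_range: "A_sharp A \<omega> *v b \<in> row_range A"
    and AtLinv_mult_A_sharp: "(AtLinv A \<omega> ** A) *v (A_sharp A \<omega> *v b) = AtLinv A \<omega> *v b"
proof -
  let ?B = "\<lambda>x. (AtLinv A \<omega> ** A) *v x"
  let ?f = "\<lambda>b. inv_into (row_range A) ?B (AtLinv A \<omega> *v b)"
  note bij = AtLinv_mult_bij [OF assms]
  have in_range: "?f b \<in> row_range A" for b
    using bij AtLinv_in_row_range [of A \<omega> b]
    by (metis bij_betw_imp_surj_on inv_into_into)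
  have B: "?B (?f b) = AtLinv A \<omega> *v b" for b
    using bij AtLinv_in_row_range [of A \<omega> b]
    by (metis bij_betw_imp_surj_on f_inv_into_f)
  \<comment> \<open>Preimages are unique within the row space, so additivity and homogeneity need
    only be checked after applying \<open>?B\<close>.\<close>
  have unique: "?f b = x" if "x \<in> row_range A" "?B x = AtLinv A \<omega> *v b" for b x
    using bij that B [of b] in_range [of b] unfolding bij_betw_def inj_on_def by metis
  have "linear ?f"
  proof (rule linearI)
    show "?f (b + c) = ?f b + ?f c" for b c
      by (intro unique subspace_add subspace_row_range in_range)
        (simp add: matrix_vector_right_distrib B)
    show "?f (s *\<^sub>R b) = s *\<^sub>R ?f b" for s b
      by (intro unique subspace_scale subspace_row_range in_range)
        (simp add: matrix_vector_mult_scaleR B)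
  qed
  then have "A_sharp A \<omega> *v b = ?f b"
    unfolding A_sharp_def by (simp add: matrix_works linear_matrix_vector_mul_eq)
  then show "A_sharp A \<omega> *v b \<in> row_range A" "?B (A_sharp A \<omega> *v b) = AtLinv A \<omega> *v b"
    using in_range B by simp_all
qed

text \<open>Since \<open>mat 1 - iter_G A \<omega>\<close> equals
  \<open>AtLinv A \<omega> ** A\<close>, the matrix \<open>AtLinv A \<omega>\<close> acquires the
  left factor that makes the sum telescope.\<close>

lemma A_sharp_k_eq:
  fixes A :: "real^'n^'m::{finite,linorder}"
  assumes "\<forall>i. row i A \<noteq> 0" and "0 < \<omega>" "\<omega> < 2"
  shows "A_sharp_k A \<omega> k = (mat 1 - matpow (iter_G A \<omega>) k) ** A_sharp A \<omega>"
proof -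
  have "AtLinv A \<omega> = (mat 1 - iter_G A \<omega>) ** A_sharp A \<omega>"
    using AtLinv_mult_A_sharp [OF assms]
    by (simp add: iter_G_def matrix_eq matrix_vector_mul_assoc [symmetric])
  then show ?thesis
    unfolding A_sharp_k_def by (simp add: matrix_mul_assoc matpow_geometric_sum)
qed

lemma iter_G_in_row_range:
  assumes "x \<in> row_range A"
  shows "iter_G A \<omega> *v x \<in> row_range A"
  using subspace_diff [OF subspace_row_range assms AtLinv_in_row_range]
  by (simp add: iter_G_def matrix_vector_mult_diff_rdistrib matrix_vector_mul_assoc [symmetric])

subsection \<open>The eigenvalue decomposition\<close>

lemma cmat_A_sharp_k_eq:
  fixes A :: "real^'n^'m::{finite,linorder}"
  assumes A: "\<forall>i. row i A \<noteq> 0" "0 < \<omega>" "\<omega> < 2"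
    and eig: "eig_decomp (iter_G A \<omega>) (row_range A) V C l"
  shows "cmat (A_sharp_k A \<omega> k) =
    eig_W V C ** (mat 1 - matpow (diag_mat l) k) ** eig_Winv V C ** cmat (A_sharp A \<omega>)"
proof -
  let ?G = "iter_G A \<omega>" and ?H = "transpose V ** iter_G A \<omega> ** V" and ?S = "A_sharp A \<omega>"
  from eig have V: "orthonormal_basis_columns V (row_range A)" and C: "invertible C"
    and H: "cmat ?H = C ** diag_mat l ** matrix_inv C"
    by (simp_all add: eig_decomp_def)
  \<comment> \<open>Invariance of the row space under \<open>?G\<close> makes \<open>V\<close>
    intertwine \<open>?G\<close> with its compression \<open>?H\<close>.\<close>
  have "V ** (transpose V ** (?G ** V)) = ?G ** V"
    using orthonormal_columns_in [OF V]
    by (intro orthonormal_columns_projection_matrix [OF V])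
      (simp add: matrix_vector_mul_assoc [symmetric] iter_G_in_row_range)
  then have GV: "matpow ?G k ** V = V ** matpow ?H k"
    by (intro matpow_intertwine) (simp add: matrix_mul_assoc)
  have "cmat ?H ** C = C ** diag_mat l"
    using H matrix_inv_left [OF C] by (simp add: matrix_mul_assoc [symmetric])
  then have "matpow (cmat ?H) k ** C = C ** matpow (diag_mat l) k"
    by (rule matpow_intertwine)
  then have diag: "(mat 1 - matpow (cmat ?H) k) ** C = C ** (mat 1 - matpow (diag_mat l) k)"
    by (simp add: matrix_diff_ldistrib matrix_diff_rdistrib)
  \<comment> \<open>The range of \<open>?S\<close> lies in the row space, so a factor
    \<open>V\<close> can be inserted for \<open>GV\<close> to act on.\<close>
  have "V ** (transpose V ** ?S) = ?S"
    by (intro orthonormal_columns_projection_matrix [OF V] A_sharp_in_row_range [OF A])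
  then have "A_sharp_k A \<omega> k = (mat 1 - matpow ?G k) ** V ** (transpose V ** ?S)"
    by (simp add: A_sharp_k_eq [OF A] matrix_mul_assoc [symmetric])
  also have "\<dots> = V ** (mat 1 - matpow ?H k) ** (transpose V ** ?S)"
    by (simp add: matrix_diff_ldistrib matrix_diff_rdistrib GV)
  finally have "cmat (A_sharp_k A \<omega> k) =
      cmat V ** (mat 1 - matpow (cmat ?H) k) ** (cmat (transpose V) ** cmat ?S)"
    by (simp add: cmat_mult cmat_diff cmat_mat_1 cmat_matpow)
  \<comment> \<open>Inserting \<open>C ** matrix_inv C\<close> creates the product that
    \<open>diag\<close> rewrites.\<close>
  also have "mat 1 - matpow (cmat ?H) k = (mat 1 - matpow (cmat ?H) k) ** C ** matrix_inv C"
    by (simp add: matrix_mul_assoc [symmetric] matrix_inv_right [OF C])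
  finally have "cmat (A_sharp_k A \<omega> k) =
      cmat V ** (C ** (mat 1 - matpow (diag_mat l) k) ** matrix_inv C) **
      (cmat (transpose V) ** cmat ?S)"
    by (simp only: diag)
  then show ?thesis
    by (simp add: eig_W_def eig_Winv_def matrix_mul_assoc)
qed

text \<open>The order matters: the opposite product is \<open>cmat (V ** transpose V)\<close>, the
  complexified projection onto \<open>S\<close>.\<close>

lemma eig_Winv_mult_eig_W:
  assumes "eig_decomp G S V C l"
  shows "eig_Winv V C ** eig_W V C = mat 1"
proof -
  from assms have V: "orthonormal_basis_columns V S" and C: "invertible C"
    by (simp_all add: eig_decomp_def)
  have "cmat (transpose V) ** cmat V = mat 1"
    by (metis cmat_mat_1 cmat_mult orthonormal_columns_transpose_mult [OF V])
  then show ?thesis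
    unfolding eig_W_def eig_Winv_def
    by (metis C matrix_inv_left matrix_mul_assoc matrix_mul_lid)
qed

lemma eig_Winv_A_sharp_k:
  fixes A :: "real^'n^'m::{finite,linorder}"
  assumes A: "\<forall>i. row i A \<noteq> 0" "0 < \<omega>" "\<omega> < 2"
    and eig: "eig_decomp (iter_G A \<omega>) (row_range A) V C l"
  shows "(eig_Winv V C *v cvec (A_sharp_k A \<omega> k *v b)) $ i =
    (1 - l $ i ^ k) * (eig_Winv V C *v cvec (A_sharp A \<omega> *v b)) $ i"
proof -
  have "eig_Winv V C ** cmat (A_sharp_k A \<omega> k) =
      (mat 1 - matpow (diag_mat l) k) ** (eig_Winv V C ** cmat (A_sharp A \<omega>))"
    unfolding cmat_A_sharp_k_eq [OF A eig]
    by (metis eig_Winv_mult_eig_W [OF eig] matrix_mul_assoc matrix_mul_lid)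
  then have "eig_Winv V C *v cvec (A_sharp_k A \<omega> k *v b) =
      (mat 1 - matpow (diag_mat l) k) *v (eig_Winv V C *v cvec (A_sharp A \<omega> *v b))"
    by (simp add: cvec_mult matrix_vector_mul_assoc)
  then show ?thesis
    by (simp add: matpow_diag_mat mat_minus_diag_mat diag_mat_mult_vec)
qed

subsection \<open>Second moments of Gaussian vectors\<close>

text \<open>Serves the degenerate law at \<open>\<sigma> = 0\<close>. Almost everywhere
  \<open>f\<close> equals the constant \<open>f x\<close>, which gives integrability.\<close>

lemma return_borel_integral:
  fixes f :: "real \<Rightarrow> real"
  assumes "f \<in> borel_measurable borel"
  shows "has_bochner_integral (return borel x) f (f x)"
proof -
  interpret prob_space "return borel x"
    by (rule prob_space_return) simp
  have "integrable (return borel x) f"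
    using assms by (intro integrable_const_bound [where B = "norm (f x)"]) (simp_all add: AE_return)
  moreover have "integral\<^sup>L (return borel x) f = f x"
    using assms by (intro integral_return) simp_all
  ultimately show ?thesis
    by (simp only: has_bochner_integral_iff)
qed

lemma normal_law_moments:
  assumes "0 \<le> \<sigma>"
  shows "has_bochner_integral (normal_law 0 \<sigma>) (\<lambda>x. x) 0"
    and "has_bochner_integral (normal_law 0 \<sigma>) (\<lambda>x. x\<^sup>2) (\<sigma>\<^sup>2)"
proof -
  have degenerate: "has_bochner_integral (normal_law 0 \<sigma>) f (f 0)"
    if "\<sigma> = 0" "f \<in> borel_measurable borel" for f :: "real \<Rightarrow> real"
    using return_borel_integral [OF that(2), of 0] that(1) by (simp only: normal_law_def simp_thms if_True)
  have density: "has_bochner_integral (normal_law 0 \<sigma>) f c"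
    if "\<sigma> \<noteq> 0" "f \<in> borel_measurable borel"
      "has_bochner_integral lborel (\<lambda>x. normal_density 0 \<sigma> x * f x) c" for f :: "real \<Rightarrow> real" and c
  proof -
    have "has_bochner_integral (density lborel (normal_density 0 \<sigma>)) f c"
      using that(2,3) by (intro has_bochner_integral_density) simp_all
    then show ?thesis
      using that(1) by (simp only: normal_law_def if_False)
  qed
  show "has_bochner_integral (normal_law 0 \<sigma>) (\<lambda>x. x) 0"
  proof (cases "\<sigma> = 0")
    case True
    then show ?thesis
      using degenerate [of "\<lambda>x. x"] by simp
  next
    case False
    \<comment> \<open>The moment facts are indexed by \<open>k\<close> for order
      \<open>2 * k + 1\<close> (odd) and \<open>2 * k\<close> (even); hence index 0 here and index 1
      for the second moment.\<close>
    then show ?thesis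
      using density [of "\<lambda>x. x" 0] normal_moment_odd [of \<sigma> 0 0] assms by simp
  qed
  show "has_bochner_integral (normal_law 0 \<sigma>) (\<lambda>x. x\<^sup>2) (\<sigma>\<^sup>2)"
  proof (cases "\<sigma> = 0")
    case True
    then show ?thesis
      using degenerate [of "\<lambda>x. x\<^sup>2"] by simp
  next
    case False
    then show ?thesis
      using density [of "\<lambda>x. x\<^sup>2" "\<sigma>\<^sup>2"] normal_moment_even [of \<sigma> 0 1] assms by simp
  qed
qed

text \<open>Diagonal entries are second moments of the marginal laws; off the diagonal, independence
  factors the expectation into two vanishing means.\<close>

lemma gaussian_vector_covariance:
  assumes M: "prob_space M" and \<sigma>: "0 \<le> \<sigma>" and e: "gaussian_vector M \<sigma> e"
  shows "has_bochner_integral M (\<lambda>w. e w $ i * e w $ j) (if i = j then \<sigma>\<^sup>2 else 0)"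
proof -
  interpret prob_space M by (rule M)
  have ind: "indep_vars (\<lambda>_. borel) (\<lambda>i w. e w $ i) UNIV"
    and law: "distr M borel (\<lambda>w. e w $ i) = normal_law 0 \<sigma>" for i
    using e by (auto simp: gaussian_vector_def)
  have meas [measurable]: "(\<lambda>w. e w $ i) \<in> borel_measurable M" for i
    using ind by (auto simp: indep_vars_def)
  have moments: "integrable M (\<lambda>w. e w $ i)" "expectation (\<lambda>w. e w $ i) = 0"
    "integrable M (\<lambda>w. (e w $ i)\<^sup>2)" "expectation (\<lambda>w. (e w $ i)\<^sup>2) = \<sigma>\<^sup>2" for i
    using normal_law_moments [OF \<sigma>] unfolding law [of i, symmetric]
    by (simp_all add: has_bochner_integral_iff integrable_distr_eq integral_distr)
  show ?thesis
  proof (cases "i = j")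
    case True
    then show ?thesis
      using moments by (simp add: has_bochner_integral_iff power2_eq_square)
  next
    case False
    moreover have "indep_vars (\<lambda>_. borel) (\<lambda>i w. e w $ i) {i, j}"
      using ind by (rule indep_vars_subset) simp
    ultimately show ?thesis
      using indep_vars_integrable [of "{i, j}" "\<lambda>i w. e w $ i"]
        indep_vars_lebesgue_integral [of "{i, j}" "\<lambda>i w. e w $ i"] moments
      by (simp add: has_bochner_integral_iff)
  qed
qed

text \<open>Expanding the square gives the quadratic form of the covariance matrix
  \<open>\<sigma>^2 I\<close> at \<open>v\<close>.\<close>

lemma gaussian_vector_inner_squared:
  fixes e :: "'a \<Rightarrow> real^'m"
  assumes "prob_space M" and "0 \<le> \<sigma>" and "gaussian_vector M \<sigma> e"
  shows "has_bochner_integral M (\<lambda>w. (v \<bullet> e w)\<^sup>2) (\<sigma>\<^sup>2 * (norm v)\<^sup>2)"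
proof -
  have "has_bochner_integral M
      (\<lambda>w. \<Sum>i\<in>UNIV. \<Sum>j\<in>UNIV. (v $ i * v $ j) * (e w $ i * e w $ j))
      (\<Sum>i\<in>UNIV. \<Sum>j\<in>UNIV. (v $ i * v $ j) * (if i = j then \<sigma>\<^sup>2 else 0))"
    by (intro has_bochner_integral_sum has_bochner_integral_mult_right
        gaussian_vector_covariance assms)
  moreover have "(v \<bullet> e w)\<^sup>2 = (\<Sum>i\<in>UNIV. \<Sum>j\<in>UNIV. (v $ i * v $ j) * (e w $ i * e w $ j))" for w
    by (simp add: inner_vec_def power2_eq_square sum_product algebra_simps)
  moreover have "(\<Sum>i\<in>UNIV. \<Sum>j\<in>UNIV. (v $ i * v $ j) * (if i = j then \<sigma>\<^sup>2 else 0)) = \<sigma>\<^sup>2 * (norm v)\<^sup>2"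
    unfolding norm_vec_squared
    by (simp add: sum_distrib_left power2_eq_square algebra_simps if_distrib cong: if_cong)
  ultimately show ?thesis
    by simp
qed

lemma gaussian_vector_norm_squared:
  fixes X :: "real^'m^'n" and e :: "'a \<Rightarrow> real^'m"
  assumes "prob_space M" and "0 \<le> \<sigma>" and "gaussian_vector M \<sigma> e"
  shows "has_bochner_integral M (\<lambda>w. (norm (X *v e w))\<^sup>2) (\<sigma>\<^sup>2 * (frobenius_norm X)\<^sup>2)"
proof -
  have "has_bochner_integral M (\<lambda>w. \<Sum>i\<in>UNIV. (X $ i \<bullet> e w)\<^sup>2) (\<Sum>i\<in>UNIV. \<sigma>\<^sup>2 * (norm (X $ i))\<^sup>2)"
    by (intro has_bochner_integral_sum gaussian_vector_inner_squared assms)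
  then show ?thesis
    by (simp add: norm_vec_squared [of "_ *v _"] matrix_vector_mul_component
        frobenius_norm_eq_norm norm_vec_squared [of X] sum_distrib_left)
qed

text \<open>As \<open>e\<close> is real, the real and imaginary parts of the component are real
  linear forms in \<open>e\<close>.\<close>

lemma gaussian_vector_complex_component:
  fixes Z :: "complex^'m^'n" and e :: "'a \<Rightarrow> real^'m"
  assumes "prob_space M" and "0 \<le> \<sigma>" and "gaussian_vector M \<sigma> e"
  shows "integrable M (\<lambda>w. (cmod ((Z *v cvec (e w)) $ i))\<^sup>2)"
proof -
  let ?re = "\<chi> j. Re (Z $ i $ j)" and ?im = "\<chi> j. Im (Z $ i $ j)"
  have "(cmod ((Z *v cvec x) $ i))\<^sup>2 = (?re \<bullet> x)\<^sup>2 + (?im \<bullet> x)\<^sup>2" for x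
    by (simp add: cmod_power2 matrix_vector_mult_def cvec_def inner_vec_def)
  then show ?thesis
    using gaussian_vector_inner_squared [OF assms, of ?re]
      gaussian_vector_inner_squared [OF assms, of ?im]
    by (simp add: has_bochner_integral_iff)
qed

text \<open>The Bochner integral of a non-integrable function is 0 by convention; the integrability
  clauses ensure that the expectations are genuine.\<close>

theorem proposition16:
  fixes A :: "real^'n^'m::{finite,linorder}" and \<omega> \<sigma> :: real
    and V :: "real^'r^'n" and C :: "complex^'r^'r" and l :: "complex^'r"
    and M :: "'a measure" and e :: "'a \<Rightarrow> real^'m::{finite,linorder}" and k :: nat
  assumes "\<forall>i. row i A \<noteq> 0"
    and "rank A = CARD('r)"
    and "0 < \<omega>" and "\<omega> < 2"
    and "eig_decomp (iter_G A \<omega>) (row_range A) V C l"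
    and "prob_space M" and "0 \<le> \<sigma>" and "gaussian_vector M \<sigma> e"
    and "1 \<le> k"
  defines "\<Phi> \<equiv> mat 1 - matpow (diag_mat l) k"
    and "\<xi> \<equiv> (\<lambda>w. eig_Winv V C *v cvec (A_sharp A \<omega> *v e w))"
    and "\<xi>k \<equiv> (\<lambda>w. eig_Winv V C *v cvec (A_sharp_k A \<omega> k *v e w))"
  shows "integrable M (\<lambda>w. (norm (A_sharp_k A \<omega> k *v e w))\<^sup>2)
    \<and> (\<integral>w. (norm (A_sharp_k A \<omega> k *v e w))\<^sup>2 \<partial>M) = \<sigma>\<^sup>2 * (frobenius_norm (A_sharp_k A \<omega> k))\<^sup>2
    \<and> \<sigma>\<^sup>2 * (frobenius_norm (A_sharp_k A \<omega> k))\<^sup>2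
        = \<sigma>\<^sup>2 * (frobenius_norm (eig_W V C ** \<Phi> ** eig_Winv V C ** cmat (A_sharp A \<omega>)))\<^sup>2
    \<and> integrable M (\<lambda>w. (norm (\<xi>k w))\<^sup>2)
    \<and> (\<forall>i. integrable M (\<lambda>w. (cmod (\<xi> w $ i))\<^sup>2))
    \<and> (\<integral>w. (norm (\<xi>k w))\<^sup>2 \<partial>M)
        = (\<Sum>i\<in>UNIV. (cmod (1 - (l $ i) ^ k))\<^sup>2 * (\<integral>w. (cmod (\<xi> w $ i))\<^sup>2 \<partial>M))"
proof -
  note A = assms(1,3,4) and eig = assms(5) and gauss = assms(6-8)
  have norm: "has_bochner_integral M (\<lambda>w. (norm (A_sharp_k A \<omega> k *v e w))\<^sup>2)
      (\<sigma>\<^sup>2 * (frobenius_norm (A_sharp_k A \<omega> k))\<^sup>2)"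
    by (rule gaussian_vector_norm_squared [OF gauss])
  have frob: "frobenius_norm (A_sharp_k A \<omega> k) =
      frobenius_norm (eig_W V C ** \<Phi> ** eig_Winv V C ** cmat (A_sharp A \<omega>))"
    unfolding \<Phi>_def cmat_A_sharp_k_eq [OF A eig, symmetric] by (rule frobenius_norm_cmat [symmetric])
  have int: "integrable M (\<lambda>w. (cmod (\<xi> w $ i))\<^sup>2)" for i
    using gaussian_vector_complex_component [OF gauss]
    by (simp add: \<xi>_def cvec_mult matrix_vector_mul_assoc)
  \<comment> \<open>The identity holds for every \<open>w\<close>, so linearity of the integral
    yields both integrability and the formula.\<close>
  have "(norm (\<xi>k w))\<^sup>2 = (\<Sum>i\<in>UNIV. (cmod (1 - l $ i ^ k))\<^sup>2 * (cmod (\<xi> w $ i))\<^sup>2)" for w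
    by (simp add: \<xi>k_def \<xi>_def norm_vec_squared eig_Winv_A_sharp_k [OF A eig] norm_mult
        power_mult_distrib)
  then show ?thesis
    using norm frob int by (simp add: has_bochner_integral_iff)
qed

end
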